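(* Let $\phi\in\mathscr{L}$. There exists a threshold $\overline{\rho}>0$ such that for every $\rho\ge\overline{\rho}$ the penalty problem $$\min_{x\in\Omega,\,w\in[0,e]}\Big\{F_{\mu}(x)+\nu\Big[\sum_{i=1}^p\phi(w_i)+\rho\langle e-w,|x|\rangle\Big]\Big\}$$ has the same global optimal solution set as the problem $$\min_{x,w\in\mathbb{R}^p}\Big\{F_{\mu}(x)+\nu\sum_{i=1}^p\phi(w_i)\ \ \text{s.t.}\ \ \langle e-w,|x|\rangle=0,\ x\in\Omega,\ w\in[0,e]\Big\}.$$ Also, this conclusion holds when $f$ (in the definition of $F_\mu$) is replaced by a lower bounded Lipschitzian function on $\mathbb{R}^n$.
   Context: Data: $f:\mathbb{R}^n\to\mathbb{R}_+$ is a piecewise linear-quadratic (nonsmooth) convex function, $A\in\mathbb{R}^{n\times p}$, $b\in\mathbb{R}^n$, $\Omega\subseteq\mathbb{R}^p$ is a nonempty polyhedral (convex) set, $\mu>0$, $\nu>0$, and $F_\mu(x):=f(Ax-b)+\frac{\mu}{2}\|x\|^2$ for $x\in\mathbb{R}^p$. $e$ is the vector of all ones, $|x|$ is the vector of absolute values of the entries of $x$, and $[0,e]$ is the box $\{w\in\mathbb{R}^p: 0\le w_i\le 1\ \forall i\}$. $\mathscr{L}$ is the family of proper lower semicontinuous functions $\phi:\mathbb{R}\to(-\infty,+\infty]$ with ${\rm int}({\rm dom}\,\phi)\supseteq[0,1]$ which are convex in the interval $[0,1]$ and satisfy: $\phi$ has a unique minimizer $t^*:=\arg\min_{0\le t\le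 1}\phi(t)$ over $[0,1]$, with $t^*<1$, $\phi(t^* )=0$ and $\phi(1)=1$.
   Formalization: It is additionally assumed that φ has a finite left derivative at 1; convexity only on [0,1] does not ensure this, and the claim fails without it, e.g. for φ(t)=1-√(1-t²) on [0,1] extended by constants, with f=|·|, A=1, b=10, Ω=ℝ, μ=0.01, ν=1. *)

theory Defs
  imports "HOL-Analysis.Analysis"
begin

(* Rockafellar-Wets, Def. 10.20, for a function with domain the whole space. *)
definition piecewise_linear_quadratic :: "(real ^ 'n \<Rightarrow> real) \<Rightarrow> bool" where
  "piecewise_linear_quadratic f \<longleftrightarrow>
     (\<exists>\<C>. finite \<C> \<and> \<Union>\<C> = UNIV \<and>
        (\<forall>C\<in>\<C>. polyhedron C \<and>
           (\<exists>(Q :: real ^ 'n ^ 'n) a \<alpha>. transpose Q = Q \<and>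
              (\<forall>y\<in>C. f y = 1 / 2 * (y \<bullet> (Q *v y)) + a \<bullet> y + \<alpha>))))"

definition effective_domain :: "('a \<Rightarrow> ereal) \<Rightarrow> 'a set" where
  "effective_domain \<phi> = {t. \<phi> t < \<infinity>}"

definition proper_function :: "('a \<Rightarrow> ereal) \<Rightarrow> bool" where
  "proper_function \<phi> \<longleftrightarrow> (\<forall>t. \<phi> t \<noteq> -\<infinity>) \<and> effective_domain \<phi> \<noteq> {}"

definition lower_semicontinuous :: "('a::topological_space \<Rightarrow> ereal) \<Rightarrow> bool" where
  "lower_semicontinuous \<phi> \<longleftrightarrow> (\<forall>t. \<phi> t \<le> Liminf (at t) \<phi>)"

definition argmin_set :: "'a set \<Rightarrow> ('a \<Rightarrow> ereal) \<Rightarrow> 'a set" where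
  "argmin_set S g = {z. is_arg_min g (\<lambda>z. z \<in> S) z}"

(* Properness and the domain condition make phi finite on [0,1], so passing to
   real values in the convexity clause loses nothing. *)
definition family_L :: "(real \<Rightarrow> ereal) set" where
  "family_L = {\<phi>. proper_function \<phi> \<and> lower_semicontinuous \<phi> \<and>
     {0..1} \<subseteq> interior (effective_domain \<phi>) \<and>
     convex_on {0..1} (\<lambda>t. real_of_ereal (\<phi> t)) \<and>
     (\<exists>t. argmin_set {0..1} \<phi> = {t} \<and> t < 1 \<and> \<phi> t = 0) \<and> \<phi> 1 = 1}"

(* The left difference quotient at 1 of a function that is convex on [0,1] always
   has a limit in (-oo,+oo]; this says that the limit is finite. It does not follow
   from membership in family_L, since convexity is required on [0,1] only
   (for instance 1 - sqrt (1 - t^2) on [0,1], extended by constants). *)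
definition finite_left_derivative_at_1 :: "(real \<Rightarrow> ereal) \<Rightarrow> bool" where
  "finite_left_derivative_at_1 \<phi> \<longleftrightarrow>
     (\<exists>d. ((\<lambda>t. real_of_ereal (\<phi> t)) has_real_derivative d) (at_left 1))"

definition abs_vec_entries :: "real ^ 'p \<Rightarrow> real ^ 'p" where
  "abs_vec_entries x = (\<chi> i. \<bar>x $ i\<bar>)"

definition ones :: "real ^ 'p" where
  "ones = (\<chi> i. 1)"

definition unit_box :: "(real ^ 'p) set" where
  "unit_box = {w. \<forall>i. 0 \<le> w $ i \<and> w $ i \<le> 1}"

definition F_mu :: "real \<Rightarrow> (real ^ 'n \<Rightarrow> real) \<Rightarrow> real ^ 'p ^ 'n \<Rightarrow> real ^ 'n \<Rightarrow> real ^ 'p \<Rightarrow> real" where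
  "F_mu \<mu> f A b x = f (A *v x - b) + \<mu> / 2 * (norm x)\<^sup>2"

definition penalty_solutions ::
  "real \<Rightarrow> real \<Rightarrow> real \<Rightarrow> (real \<Rightarrow> ereal) \<Rightarrow> (real ^ 'n \<Rightarrow> real) \<Rightarrow> real ^ 'p ^ 'n \<Rightarrow> real ^ 'n
    \<Rightarrow> (real ^ 'p) set \<Rightarrow> ((real ^ 'p) \<times> (real ^ 'p)) set" where
  "penalty_solutions \<rho> \<mu> \<nu> \<phi> f A b \<Omega> =
     argmin_set {(x, w). x \<in> \<Omega> \<and> w \<in> unit_box}
       (\<lambda>(x, w). ereal (F_mu \<mu> f A b x)
          + ereal \<nu> * ((\<Sum>i\<in>UNIV. \<phi> (w $ i)) + ereal (\<rho> * ((ones - w) \<bullet> abs_vec_entries x))))"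

definition constrained_solutions ::
  "real \<Rightarrow> real \<Rightarrow> (real \<Rightarrow> ereal) \<Rightarrow> (real ^ 'n \<Rightarrow> real) \<Rightarrow> real ^ 'p ^ 'n \<Rightarrow> real ^ 'n
    \<Rightarrow> (real ^ 'p) set \<Rightarrow> ((real ^ 'p) \<times> (real ^ 'p)) set" where
  "constrained_solutions \<mu> \<nu> \<phi> f A b \<Omega> =
     argmin_set {(x, w). (ones - w) \<bullet> abs_vec_entries x = 0 \<and> x \<in> \<Omega> \<and> w \<in> unit_box}
       (\<lambda>(x, w). ereal (F_mu \<mu> f A b x) + ereal \<nu> * (\<Sum>i\<in>UNIV. \<phi> (w $ i)))"

end

theory Submission imports Defs begin

text \<open>
  For fixed \<open>x\<close> the penalized problem separates over the coordinates of \<open>w\<close>. With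
  \<open>\<sigma> = \<rho> * \<bar>x\<^sub>i\<bar>\<close> and \<open>d\<close> the left derivative of \<open>\<phi>\<close> at 1, the tangent bound
  \<open>\<phi> t \<ge> 1 - d * (1 - t)\<close> gives two regimes for the cost \<open>\<phi> t + \<sigma> * (1 - t)\<close>: if \<open>\<sigma> > d\<close> it is at
  least 1, with equality only for \<open>t = 1\<close>; if \<open>\<sigma> \<le> d\<close> it is at least \<open>\<sigma> / d\<close>. So a large entry of
  \<open>x\<close> costs as much as in the constrained problem, where a nonzero entry forces the weight 1,
  and a small entry costs at least \<open>\<rho> / d\<close> times its modulus.

  Hence it pays to move to a point of \<open>\<Omega>\<close> at which the small entries vanish, provided that the
  distance to be travelled is at most a constant times the sum of their moduli: the change of
  \<open>F\<^sub>\<mu>\<close> is then a fixed multiple of that sum (its Lipschitz constant times the distance), and the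
  saving exceeds it once \<open>\<rho>\<close> is large. Such an error bound holds on polytopes
  (\<open>polytope_zero_set_error_bound\<close>, \<open>polytope_sparsification_bound\<close>), and \<open>\<Omega>\<close> may be cut down to a
  polytope because \<open>F\<^sub>\<mu>\<close> is coercive. The result (\<open>exact_penalty_domination\<close>) is that every
  point feasible for the penalty problem only is strictly worse than some point feasible for both;
  as the two objectives agree on the latter points, the solution sets coincide, whether or
  not they are empty. Both classes of functions in the theorem enter through a lower bound, which
  gives coercivity, and Lipschitz continuity on bounded sets; for convex \<open>f\<close> the latter is
  \<open>convex_on_UNIV_imp_lipschitz_on_bounded\<close>.
\<close>

section \<open>Error bounds on polytopes\<close>

text \<open>
  Write \<open>x\<close> as a convex combination of the vertices. The total weight of the vertices with
  \<open>s > 0\<close> is at most \<open>s x\<close> divided by the least positive value of \<open>s\<close> at a vertex; if it is less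
  than 1, there is a vertex with \<open>s = 0\<close>, and shifting all of that weight to it moves \<open>x\<close> by at most
  the weight times the diameter.
\<close>

lemma polytope_zero_set_error_bound:
  fixes P :: "'a::euclidean_space set" and s :: "'a \<Rightarrow> real"
  assumes "polytope P" and "linear s" and nonneg: "\<And>x. x \<in> P \<Longrightarrow> 0 \<le> s x"
  shows "\<exists>m>0. \<exists>\<gamma>>0. \<forall>x\<in>P. s x < m \<longrightarrow> (\<exists>y\<in>P. s y = 0 \<and> norm (x - y) \<le> \<gamma> * s x)"
proof -
  interpret s: linear s by fact
  obtain V where V: "finite V" "P = convex hull V"
    using assms(1) unfolding polytope_def by blast
  have VP: "v \<in> P" if "v \<in> V" for v
    using V(2) that by (simp add: hull_inc)
  define V1 where "V1 = {v \<in> V. s v \<noteq> 0}"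
  have V1: "finite V1" "V1 \<subseteq> V" using V(1) by (auto simp: V1_def)
  \<comment> \<open>The extra elements 1 only serve to keep the sets nonempty and the bounds positive.\<close>
  define m where "m = Min (insert 1 (s ` V1))"
  have m_pos: "m > 0"
    unfolding m_def using V1(1) nonneg[OF VP] by (subst Min_gr_iff) (auto simp: V1_def order_less_le)
  have m_le: "m \<le> s v" if "v \<in> V1" for v
    unfolding m_def using that V1(1) by (intro Min_le) auto
  define D where "D = Max (insert 1 ((\<lambda>(v, w). norm (v - w)) ` (V \<times> V)))"
  have fin: "finite (insert 1 ((\<lambda>(v, w). norm (v - w)) ` (V \<times> V)))" using V(1) by simp
  have D_pos: "D > 0"
    using Max_ge[OF fin, of 1] unfolding D_def by simp
  have D_ge: "norm (v - w) \<le> D" if "v \<in> V" "w \<in> V" for v w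
    unfolding D_def using that by (intro Max_ge[OF fin]) auto
  have "\<exists>y\<in>P. s y = 0 \<and> norm (x - y) \<le> (D / m) * s x" if "x \<in> P" "s x < m" for x
  proof -
    from \<open>x \<in> P\<close> obtain u where u: "\<And>v. v \<in> V \<Longrightarrow> 0 \<le> u v" "sum u V = 1" "(\<Sum>v\<in>V. u v *\<^sub>R v) = x"
      unfolding V(2) convex_hull_finite[OF V(1)] by blast
    have "s x = (\<Sum>v\<in>V. u v * s v)"
      unfolding u(3)[symmetric] by (simp add: s.sum s.scale)
    also have "\<dots> = (\<Sum>v\<in>V1. u v * s v)"
      by (rule sum.mono_neutral_right) (auto simp: V(1) V1_def)
    also have "\<dots> \<ge> (\<Sum>v\<in>V1. u v * m)"
      using u(1) V1(2) m_le by (intro sum_mono mult_left_mono) auto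
    finally have weight: "m * sum u V1 \<le> s x"
      by (simp add: sum_distrib_left mult.commute)
    have "V1 \<noteq> V"
    proof
      assume "V1 = V"
      with weight u(2) have "m \<le> s x" by simp
      with \<open>s x < m\<close> show False by simp
    qed
    then obtain v0 where v0: "v0 \<in> V" "s v0 = 0" by (auto simp: V1_def)
    define r where "r v = (if v \<in> V1 then v0 else v)" for v
    define y where "y = (\<Sum>v\<in>V. u v *\<^sub>R r v)"
    have "y \<in> P"
      unfolding y_def V(2)
      using V(1) u v0(1) by (intro convex_sum) (auto simp: r_def hull_inc)
    moreover have "s y = 0"
      unfolding y_def using v0 by (auto simp: s.sum s.scale r_def V1_def intro!: sum.neutral)
    moreover have "norm (x - y) \<le> (D / m) * s x"
    proof -
      have "x - y = (\<Sum>v\<in>V. u v *\<^sub>R (v - r v))"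
        unfolding y_def u(3)[symmetric] by (simp add: sum_subtractf scaleR_diff_right)
      also have "\<dots> = (\<Sum>v\<in>V1. u v *\<^sub>R (v - v0))"
        using V1 by (intro sum.mono_neutral_cong_right) (auto simp: V(1) r_def)
      finally have "norm (x - y) \<le> (\<Sum>v\<in>V1. norm (u v *\<^sub>R (v - v0)))"
        by (simp only: norm_sum)
      also have "\<dots> \<le> (\<Sum>v\<in>V1. u v * D)"
        using u(1) V1(2) D_ge v0(1) by (intro sum_mono) (auto simp: subset_iff intro!: mult_mono)
      also have "\<dots> = D * sum u V1"
        by (simp add: sum_distrib_left mult.commute)
      also have "\<dots> \<le> D * (s x / m)"
        using weight m_pos D_pos by (intro mult_left_mono) (auto simp: field_simps)
      finally show ?thesis by simp
    qed
    ultimately show ?thesis by blast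
  qed
  moreover have "D / m > 0" using D_pos m_pos by simp
  ultimately show ?thesis using m_pos by blast
qed

text \<open>
  On a single orthant the sum of moduli is linear, so the preceding bound applies to each orthant
  piece of \<open>P\<close>; finitely many sets \<open>I\<close> and orthants make the constants uniform.
\<close>

lemma polytope_sparsification_bound:
  fixes P :: "(real ^ 'p) set"
  assumes "polytope P"
  shows "\<exists>m>0. \<exists>\<gamma>>0. \<forall>I. \<forall>x\<in>P. (\<Sum>i\<in>I. \<bar>x $ i\<bar>) < m \<longrightarrow>
           (\<exists>y\<in>P. (\<forall>i\<in>I. y $ i = 0) \<and> norm (x - y) \<le> \<gamma> * (\<Sum>i\<in>I. \<bar>x $ i\<bar>))"
proof -
  define orth where "orth J = (\<Inter>i. {x :: real ^ 'p. if i \<in> J then x $ i \<ge> 0 else x $ i \<le> 0})"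
    for J :: "'p set"
  have half: "polyhedron {x :: real ^ 'p. if i \<in> J then x $ i \<ge> 0 else x $ i \<le> 0}" for i J
    using polyhedron_halfspace_ge[where a = "axis i 1 :: real ^ 'p" and b = 0]
      polyhedron_halfspace_le[where a = "axis i 1 :: real ^ 'p" and b = 0]
    by (cases "i \<in> J") (simp_all add: inner_axis')
  have poly: "polytope (P \<inter> orth J)" for J
    unfolding orth_def using half by (intro polytope_Int_polyhedron assms polyhedron_Inter) auto
  define s where "s I J x = (\<Sum>i\<in>I. if i \<in> J then x $ i else - (x $ i))"
    for I J :: "'p set" and x :: "real ^ 'p"
  have s_lin: "linear (s I J)" for I J
    unfolding s_def
    by (rule linearI) (auto simp: sum.distrib[symmetric] sum_distrib_left intro!: sum.cong)
  have s_eq: "s I J x = (\<Sum>i\<in>I. \<bar>x $ i\<bar>)" if "x \<in> orth J" for I J x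
    unfolding s_def using that by (intro sum.cong) (auto simp: orth_def split: if_splits)
  define ok where "ok I J m \<gamma> \<longleftrightarrow> m > 0 \<and> \<gamma> > 0 \<and>
      (\<forall>x\<in>P \<inter> orth J. s I J x < m \<longrightarrow>
        (\<exists>y\<in>P \<inter> orth J. s I J y = 0 \<and> norm (x - y) \<le> \<gamma> * s I J x))" for I J m \<gamma>
  have "\<exists>m \<gamma>. ok I J m \<gamma>" for I J
    unfolding ok_def
    using polytope_zero_set_error_bound[OF poly[of J] s_lin[of I J]] s_eq[of _ J I]
    by (auto simp: sum_nonneg)
  then obtain m \<gamma> where ok: "\<And>I J. ok I J (m I J) (\<gamma> I J)" by metis
  then have m_pos: "m I J > 0" and g_pos: "\<gamma> I J > 0"
    and bound: "x \<in> P \<inter> orth J \<Longrightarrow> s I J x < m I J \<Longrightarrow>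
          \<exists>y\<in>P \<inter> orth J. s I J y = 0 \<and> norm (x - y) \<le> \<gamma> I J * s I J x" for I J x
    by (auto simp: ok_def)
  define m' where "m' = Min (range (\<lambda>(I, J). m I J))"
  define \<gamma>' where "\<gamma>' = Max (range (\<lambda>(I, J). \<gamma> I J))"
  have fin: "finite (UNIV :: ('p set \<times> 'p set) set)" by simp
  have "m' > 0" unfolding m'_def using m_pos by (subst Min_gr_iff) auto
  moreover have m'_le: "m' \<le> m I J" for I J
    unfolding m'_def by (intro Min_le) (auto intro!: range_eqI[of _ _ "(I, J)"])
  moreover have g'_ge: "\<gamma> I J \<le> \<gamma>'" for I J
    unfolding \<gamma>'_def by (intro Max_ge) (auto intro!: range_eqI[of _ _ "(I, J)"])
  moreover have "\<gamma>' > 0" using less_le_trans[OF g_pos g'_ge] .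
  moreover have "\<exists>y\<in>P. (\<forall>i\<in>I. y $ i = 0) \<and> norm (x - y) \<le> \<gamma>' * (\<Sum>i\<in>I. \<bar>x $ i\<bar>)"
    if "x \<in> P" "(\<Sum>i\<in>I. \<bar>x $ i\<bar>) < m'" for I x
  proof -
    define J where "J = {i. x $ i \<ge> 0}"
    have x: "x \<in> P \<inter> orth J" using \<open>x \<in> P\<close> by (auto simp: orth_def J_def)
    with s_eq[of x J I] that(2) m'_le[of I J] have "s I J x < m I J" by auto
    with bound[OF x] obtain y where y: "y \<in> P" "y \<in> orth J" "s I J y = 0"
      "norm (x - y) \<le> \<gamma> I J * s I J x" by blast
    have "\<forall>i\<in>I. y $ i = 0"
      using y(3) s_eq[OF y(2), of I] by (simp add: sum_nonneg_eq_0_iff)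
    moreover have "\<gamma> I J * s I J x \<le> \<gamma>' * s I J x"
      using g'_ge[of I J] s_eq[of x J I] x by (intro mult_right_mono) (auto simp: sum_nonneg)
    ultimately show ?thesis using y s_eq[of x J I] x by (intro bexI[of _ y]) auto
  qed
  ultimately show ?thesis by blast
qed

section \<open>Lipschitz continuity on bounded sets\<close>

text \<open>
  Extend the segment from \<open>x\<close> through \<open>y\<close> by length 1 to \<open>z\<close>. Convexity bounds the slope between \<open>x\<close> and
  \<open>y\<close> by the slope between \<open>x\<close> and \<open>z\<close>, whose denominator is at least 1, while
  the numerator is bounded on a compact ball.
\<close>

lemma convex_on_UNIV_imp_lipschitz_on_bounded:
  fixes f :: "'a::euclidean_space \<Rightarrow> real"
  assumes cvx: "convex_on UNIV f" and "bounded S"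
  shows "\<exists>L. L-lipschitz_on S f"
proof -
  obtain R where R: "\<And>x. x \<in> S \<Longrightarrow> norm x \<le> R"
    using \<open>bounded S\<close> by (auto simp: bounded_iff)
  have "continuous_on (cball 0 (R + 1)) f"
    using convex_on_continuous[OF open_UNIV cvx] continuous_on_subset by blast
  then have "bounded (f ` cball 0 (R + 1))"
    by (intro compact_imp_bounded compact_continuous_image) auto
  then obtain M where M: "\<And>x. norm x \<le> R + 1 \<Longrightarrow> \<bar>f x\<bar> \<le> M"
    unfolding bounded_iff by (metis imageI mem_cball_0 real_norm_def)
  have slope: "f y - f x \<le> 2 * M * norm (y - x)" if "x \<in> S" "y \<in> S" for x y
  proof (cases "x = y")
    case False
    define n where "n = norm (y - x)"
    have n: "n > 0" using False by (simp add: n_def)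
    define z where "z = y + (1 / n) *\<^sub>R (y - x)"
    define t where "t = n / (n + 1)"
    have t: "0 \<le> t" "t \<le> 1" "t \<le> n" using n by (auto simp: t_def field_simps)
    have "norm z \<le> norm y + norm ((1 / n) *\<^sub>R (y - x))"
      unfolding z_def by (rule norm_triangle_ineq)
    also have "\<dots> \<le> R + 1" using R[OF \<open>y \<in> S\<close>] n by (simp add: n_def)
    finally have z: "\<bar>f z\<bar> \<le> M" by (rule M)
    have x: "\<bar>f x\<bar> \<le> M" using R[OF \<open>x \<in> S\<close>] by (intro M) simp
    have "z - x = ((n + 1) / n) *\<^sub>R (y - x)"
      using n by (simp add: z_def add_divide_distrib scaleR_add_left)
    then have "t *\<^sub>R (z - x) = y - x"
      using n by (simp add: t_def)
    then have "y = (1 - t) *\<^sub>R x + t *\<^sub>R z"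
      by (simp add: algebra_simps)
    then have "f y \<le> (1 - t) * f x + t * f z"
      using convex_onD[OF cvx t(1,2), of x z] by simp
    then have "f y - f x \<le> t * (f z - f x)" by (simp add: algebra_simps)
    also have "\<dots> \<le> t * (2 * M)" using x z t by (intro mult_left_mono) auto
    also have "\<dots> \<le> n * (2 * M)" using x t by (intro mult_right_mono) auto
    finally show ?thesis by (simp add: n_def mult.commute)
  qed simp
  have "(max 0 (2 * M))-lipschitz_on S f"
  proof (rule lipschitz_onI)
    fix x y assume "x \<in> S" "y \<in> S"
    then have "dist (f x) (f y) \<le> 2 * M * dist x y"
      using slope[of x y] slope[of y x] by (auto simp: dist_real_def dist_norm norm_minus_commute)
    also have "\<dots> \<le> max 0 (2 * M) * dist x y" by (intro mult_right_mono) auto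
    finally show "dist (f x) (f y) \<le> max 0 (2 * M) * dist x y" .
  qed simp
  then show ?thesis by blast
qed

lemma F_mu_lipschitz_on_bounded:
  fixes A :: "real ^ 'p ^ 'n"
  assumes lip: "\<And>S. bounded S \<Longrightarrow> \<exists>L. L-lipschitz_on S f" and "\<mu> > 0" and "bounded S"
  shows "\<exists>L. L-lipschitz_on S (F_mu \<mu> f A b)"
proof -
  have "bounded ((\<lambda>x. A *v x) ` S)"
    using \<open>bounded S\<close> by (rule bounded_linear_image) simp
  then have "bounded ((\<lambda>x. A *v x - b) ` S)"
    using bounded_translation_minus[of "(\<lambda>x. A *v x) ` S" b]
    by (simp add: image_image)
  then obtain L where L: "L-lipschitz_on ((\<lambda>x. A *v x - b) ` S) f"
    using lip by blast
  obtain K where K: "\<And>x. norm (A *v x) \<le> norm x * K" "K \<ge> 0"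
    using bounded_linear.nonneg_bounded[OF matrix_vector_mul_bounded_linear[of A]] by blast
  obtain R where R: "\<And>x. x \<in> S \<Longrightarrow> norm x \<le> R" "R \<ge> 0"
    using \<open>bounded S\<close> by (metis bounded_pos less_imp_le)
  have "(L * K + \<mu> * R)-lipschitz_on S (F_mu \<mu> f A b)"
  proof (rule lipschitz_onI)
    fix x y assume xy: "x \<in> S" "y \<in> S"
    have "\<bar>f (A *v x - b) - f (A *v y - b)\<bar> \<le> L * norm (A *v (x - y))"
      using lipschitz_onD[OF L, of "A *v x - b" "A *v y - b"] xy
      by (simp add: dist_norm matrix_vector_mult_diff_distrib)
    also have "\<dots> \<le> L * (norm (x - y) * K)"
      using K lipschitz_on_nonneg[OF L] by (intro mult_left_mono) auto
    finally have 1: "\<bar>f (A *v x - b) - f (A *v y - b)\<bar> \<le> L * K * norm (x - y)"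
      by (simp add: algebra_simps)
    have "\<bar>(norm x)\<^sup>2 - (norm y)\<^sup>2\<bar> = \<bar>norm x - norm y\<bar> * (norm x + norm y)"
      by (simp add: power2_eq_square square_diff_square_factored abs_mult)
    also have "\<dots> \<le> norm (x - y) * (2 * R)"
      using R(1)[OF xy(1)] R(1)[OF xy(2)] norm_triangle_ineq3[of x y]
      by (intro mult_mono) auto
    finally have "\<mu> / 2 * \<bar>(norm x)\<^sup>2 - (norm y)\<^sup>2\<bar> \<le> \<mu> / 2 * (norm (x - y) * (2 * R))"
      using \<open>\<mu> > 0\<close> by (intro mult_left_mono) auto
    moreover have "\<bar>\<mu> / 2 * (norm x)\<^sup>2 - \<mu> / 2 * (norm y)\<^sup>2\<bar> = \<mu> / 2 * \<bar>(norm x)\<^sup>2 - (norm y)\<^sup>2\<bar>"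
      using \<open>\<mu> > 0\<close> by (simp only: right_diff_distrib[symmetric] abs_mult abs_of_pos half_gt_zero)
    ultimately have 2: "\<bar>\<mu> / 2 * (norm x)\<^sup>2 - \<mu> / 2 * (norm y)\<^sup>2\<bar> \<le> \<mu> * R * norm (x - y)"
      by (simp add: mult_ac)
    show "dist (F_mu \<mu> f A b x) (F_mu \<mu> f A b y) \<le> (L * K + \<mu> * R) * dist x y"
      using 1 2 unfolding F_mu_def dist_real_def dist_norm distrib_right by linarith
  qed (use K R lipschitz_on_nonneg[OF L] \<open>\<mu> > 0\<close> in auto)
  then show ?thesis by blast
qed

lemma F_mu_coercive:
  fixes f :: "real ^ 'n \<Rightarrow> real"
  assumes "bdd_below (range f)" and "\<mu> > 0"
  shows "\<exists>R. \<forall>x. norm x > R \<longrightarrow> F_mu \<mu> f A b x > B"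
proof -
  obtain c where c: "\<And>y. c \<le> f y" using assms(1) by (auto simp: bdd_below_def)
  define K where "K = 2 * \<bar>B - c\<bar> / \<mu>"
  have "F_mu \<mu> f A b x > B" if "norm x > 1 + K" for x
  proof -
    have "K \<ge> 0" using \<open>\<mu> > 0\<close> by (simp add: K_def)
    then have "norm x > K" "norm x \<ge> 1" using that by auto
    then have "K < (norm x)\<^sup>2"
      using power_increasing[of 1 2 "norm x"] by simp
    then have "\<bar>B - c\<bar> < \<mu> / 2 * (norm x)\<^sup>2"
      using \<open>\<mu> > 0\<close> by (simp add: K_def field_simps)
    then show ?thesis using c[of "A *v x - b"] unfolding F_mu_def by linarith
  qed
  then show ?thesis by blast
qed

section \<open>The scalar penalty\<close>

text \<open>
  The difference quotients of a convex function at the right endpoint increase towards the left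
  derivative.
\<close>

lemma convex_on_Icc_above_left_tangent:
  fixes \<psi> :: "real \<Rightarrow> real"
  assumes cvx: "convex_on {a..c} \<psi>" and der: "(\<psi> has_real_derivative d) (at_left c)"
    and t: "a \<le> t" "t \<le> c"
  shows "\<psi> c - d * (c - t) \<le> \<psi> t"
proof (cases "t = c")
  case False
  with t have "t < c" by simp
  have lim: "((\<lambda>u. (\<psi> u - \<psi> c) / (u - c)) \<longlongrightarrow> d) (at_left c)"
    using der by (simp add: has_field_derivative_iff)
  have "\<forall>\<^sub>F u in at_left c. (\<psi> t - \<psi> c) / (t - c) \<le> (\<psi> u - \<psi> c) / (u - c)"
    using eventually_at_left_real[OF \<open>t < c\<close>]
  proof eventually_elim
    case (elim u)
    then show ?case using convex_on_slope_le(2)[OF cvx, of t c u] t by auto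
  qed
  then have "(\<psi> t - \<psi> c) / (t - c) \<le> d"
    using tendsto_lowerbound[OF lim] by simp
  then show ?thesis using \<open>t < c\<close> by (simp add: field_simps)
qed simp

text \<open>For \<open>d * (1 - t) \<ge> 1\<close> the summand \<open>\<sigma> * (1 - t)\<close> alone suffices; otherwise the tangent bound does.\<close>

lemma small_entry_cost:
  fixes d \<sigma> t p :: real
  assumes "p \<ge> 0" "p \<ge> 1 - d * (1 - t)" "d > 0" "0 \<le> \<sigma>" "\<sigma> \<le> d"
  shows "\<sigma> / d \<le> p + \<sigma> * (1 - t)"
proof (cases "d * (1 - t) \<ge> 1")
  case True
  then have "\<sigma> * 1 \<le> \<sigma> * (d * (1 - t))" using assms(4) by (rule mult_left_mono)
  then have "\<sigma> / d \<le> \<sigma> * (1 - t)" using assms(3) by (simp add: field_simps)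
  then show ?thesis using assms(1) by simp
next
  case False
  then have "0 \<le> (1 - d * (1 - t)) * (d - \<sigma>)" using assms by (intro mult_nonneg_nonneg) auto
  then have "\<sigma> \<le> d * (1 - d * (1 - t) + \<sigma> * (1 - t))" by (simp add: algebra_simps)
  then have "\<sigma> / d \<le> 1 - d * (1 - t) + \<sigma> * (1 - t)" using assms(3) by (simp add: field_simps)
  then show ?thesis using assms(2) by simp
qed

lemma ones_minus_inner_abs: "(ones - w) \<bullet> abs_vec_entries x = (\<Sum>i\<in>UNIV. (1 - w $ i) * \<bar>x $ i\<bar>)"
  by (simp add: ones_def abs_vec_entries_def inner_vec_def)

section \<open>Domination by complementary points\<close>

text \<open>
  Let \<open>I\<close> be the set of small entries, those with \<open>\<rho> * \<bar>x\<^sub>i\<bar> \<le> d\<close>. The competitor \<open>y\<close> has zero entries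
  on \<open>I\<close>; giving it the weights \<open>t\<close> on \<open>I\<close> and 1 elsewhere makes it feasible
  at cost at most the number of large entries, whichever of them survive in \<open>y\<close>. Points far
  away are dominated by \<open>x0\<close> with all weights 1.
\<close>

lemma exact_penalty_domination:
  fixes \<Omega> :: "(real ^ 'p) set" and F :: "real ^ 'p \<Rightarrow> real" and \<psi> :: "real \<Rightarrow> real"
  assumes "polyhedron \<Omega>" and x0: "x0 \<in> \<Omega>" and "\<nu> > 0" and "d > 0"
    and nonneg: "\<And>t. 0 \<le> t \<Longrightarrow> t \<le> 1 \<Longrightarrow> 0 \<le> \<psi> t"
    and tangent: "\<And>t. 0 \<le> t \<Longrightarrow> t \<le> 1 \<Longrightarrow> 1 - d * (1 - t) \<le> \<psi> t"
    and one: "\<psi> 1 = 1" and zero: "\<psi> t = 0" "0 \<le> t" "t \<le> 1"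
    and lip: "\<And>S. bounded S \<Longrightarrow> \<exists>L. L-lipschitz_on S F"
    and coercive: "\<And>x. norm x > R \<Longrightarrow> F x > F x0 + \<nu> * real CARD('p)"
  shows "\<exists>\<rho>0>0. \<forall>\<rho>\<ge>\<rho>0. \<forall>x\<in>\<Omega>. \<forall>w\<in>unit_box. (ones - w) \<bullet> abs_vec_entries x \<noteq> 0 \<longrightarrow>
     (\<exists>y\<in>\<Omega>. \<exists>v\<in>unit_box. (ones - v) \<bullet> abs_vec_entries y = 0 \<and>
        F y + \<nu> * (\<Sum>i\<in>UNIV. \<psi> (v $ i)) <
        F x + \<nu> * ((\<Sum>i\<in>UNIV. \<psi> (w $ i)) + \<rho> * ((ones - w) \<bullet> abs_vec_entries x)))"
proof -
  define P where "P = \<Omega> \<inter> cbox (\<chi> i. - R) (\<chi> i. R)"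
  have "polytope P"
    unfolding P_def by (simp add: polyhedron_Int_polytope assms(1) polytope_interval)
  then obtain m \<gamma> where "m > 0" "\<gamma> > 0" and sparse:
    "\<And>I x. x \<in> P \<Longrightarrow> (\<Sum>i\<in>I. \<bar>x $ i\<bar>) < m \<Longrightarrow>
           \<exists>y\<in>P. (\<forall>i\<in>I. y $ i = 0) \<and> norm (x - y) \<le> \<gamma> * (\<Sum>i\<in>I. \<bar>x $ i\<bar>)"
    using polytope_sparsification_bound by metis
  obtain L where L: "L-lipschitz_on P F"
    using lip polytope_imp_bounded[OF \<open>polytope P\<close>] by blast
  have "L \<ge> 0" by (rule lipschitz_on_nonneg[OF L])
  \<comment> \<open>The first bound makes the small entries of \<open>x\<close> fall below \<open>m\<close> in total, the
     second makes the saving outweigh the change of \<open>F\<close>.\<close>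
  define \<rho>0 where "\<rho>0 = real CARD('p) * d / m + L * \<gamma> * d / \<nu> + 1"
  have *: "real CARD('p) * d / m \<ge> 0" "L * \<gamma> * d / \<nu> \<ge> 0"
    using \<open>m > 0\<close> \<open>\<gamma> > 0\<close> \<open>d > 0\<close> \<open>\<nu> > 0\<close> \<open>L \<ge> 0\<close> by simp_all
  then have "\<rho>0 > 0" by (simp add: \<rho>0_def)
  moreover have "\<exists>y\<in>\<Omega>. \<exists>v\<in>unit_box. (ones - v) \<bullet> abs_vec_entries y = 0 \<and>
        F y + \<nu> * (\<Sum>i\<in>UNIV. \<psi> (v $ i)) <
        F x + \<nu> * ((\<Sum>i\<in>UNIV. \<psi> (w $ i)) + \<rho> * ((ones - w) \<bullet> abs_vec_entries x))"
    if "\<rho> \<ge> \<rho>0" "x \<in> \<Omega>" "w \<in> unit_box" and bad: "(ones - w) \<bullet> abs_vec_entries x \<noteq> 0" for \<rho> x w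
  proof -
    have "\<rho> > 0" using \<open>\<rho>0 > 0\<close> that(1) by simp
    have w: "0 \<le> w $ i" "w $ i \<le> 1" for i using \<open>w \<in> unit_box\<close> by (auto simp: unit_box_def)
    define c where "c i = \<psi> (w $ i) + \<rho> * \<bar>x $ i\<bar> * (1 - w $ i)" for i
    have cost: "(\<Sum>i\<in>UNIV. \<psi> (w $ i)) + \<rho> * ((ones - w) \<bullet> abs_vec_entries x) = sum c UNIV"
      by (simp add: c_def ones_minus_inner_abs sum.distrib sum_distrib_left mult_ac)
    have c_nonneg: "c i \<ge> 0" for i
      using nonneg[OF w] w[of i] \<open>\<rho> > 0\<close> by (simp add: c_def)
    show ?thesis
    proof (cases "norm x > R")
      case True
      have "(\<Sum>i\<in>(UNIV :: 'p set). \<psi> (ones $ i)) = real CARD('p)"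
        by (simp add: ones_def one)
      moreover have "F x0 + \<nu> * real CARD('p) < F x + \<nu> * sum c UNIV"
        using coercive[OF True] \<open>\<nu> > 0\<close> sum_nonneg[of UNIV c] c_nonneg
        by (smt (verit) mult_nonneg_nonneg)
      moreover have "(ones :: real ^ 'p) \<in> unit_box" by (simp add: unit_box_def ones_def)
      ultimately show ?thesis using x0 cost by (intro bexI[of _ x0] bexI[of _ ones]) auto
    next
      case False
      have "x \<in> P"
        using \<open>x \<in> \<Omega>\<close> False component_le_norm_cart[of x]
        by (auto simp: P_def mem_box_cart abs_le_iff) (smt (verit))+
      define I where "I = {i. \<rho> * \<bar>x $ i\<bar> \<le> d}"
      define \<delta> where "\<delta> = (\<Sum>i\<in>I. \<bar>x $ i\<bar>)"
      have "\<delta> \<ge> 0" by (simp add: \<delta>_def sum_nonneg)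
      have "\<delta> \<le> (\<Sum>i\<in>I. d / \<rho>)"
        unfolding \<delta>_def using \<open>\<rho> > 0\<close> by (intro sum_mono) (auto simp: I_def field_simps)
      also have "\<dots> \<le> real CARD('p) * (d / \<rho>)"
        using \<open>\<rho> > 0\<close> \<open>d > 0\<close> by (auto intro!: divide_right_mono mult_right_mono card_mono)
      also have "\<dots> < m"
      proof -
        have "real CARD('p) * d / m < \<rho>" using that(1) * by (simp add: \<rho>0_def)
        then show ?thesis using \<open>m > 0\<close> \<open>\<rho> > 0\<close> by (simp add: field_simps)
      qed
      finally obtain y where y: "y \<in> P" "\<And>i. i \<in> I \<Longrightarrow> y $ i = 0" "norm (x - y) \<le> \<gamma> * \<delta>"
        using sparse[OF \<open>x \<in> P\<close>, of I] unfolding \<delta>_def by blast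
      define v :: "real ^ 'p" where "v = (\<chi> i. if i \<in> I then t else 1)"
      have v: "v \<in> unit_box" using zero by (simp add: unit_box_def v_def)
      have compl: "(ones - v) \<bullet> abs_vec_entries y = 0"
        unfolding ones_minus_inner_abs by (rule sum.neutral) (simp add: v_def y(2))
      have "(\<Sum>i\<in>UNIV. \<psi> (v $ i)) = (\<Sum>i\<in>UNIV. if i \<in> - I then 1 else 0)"
        by (intro sum.cong) (auto simp: v_def one zero)
      also have "\<dots> = real (card (- I))"
        by (simp add: sum.If_cases flip: Compl_eq)
      finally have val_y: "(\<Sum>i\<in>UNIV. \<psi> (v $ i)) = real (card (- I))" .
      have "F y - F x \<le> L * norm (x - y)"
        using lipschitz_onD[OF L \<open>x \<in> P\<close> y(1)] by (simp add: dist_norm)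
      also have "\<dots> \<le> L * (\<gamma> * \<delta>)" using y(3) \<open>L \<ge> 0\<close> by (rule mult_left_mono)
      finally have change: "F y - F x \<le> L * \<gamma> * \<delta>" by simp
      have rate: "L * \<gamma> < \<nu> * (\<rho> / d)"
      proof -
        have "L * \<gamma> * d / \<nu> < \<rho>" using that(1) * by (simp add: \<rho>0_def)
        then show ?thesis using \<open>\<nu> > 0\<close> \<open>d > 0\<close> by (simp add: field_simps)
      qed
      have small: "\<rho> / d * \<delta> \<le> sum c I"
        unfolding \<delta>_def sum_distrib_left
      proof (rule sum_mono)
        fix i assume "i \<in> I"
        then have "\<rho> * \<bar>x $ i\<bar> / d \<le> c i"
          unfolding c_def using nonneg[OF w] tangent[OF w] \<open>d > 0\<close> \<open>\<rho> > 0\<close>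
          by (intro small_entry_cost) (auto simp: I_def)
        then show "\<rho> / d * \<bar>x $ i\<bar> \<le> c i" by simp
      qed
      have large: "1 + (\<rho> * \<bar>x $ i\<bar> - d) * (1 - w $ i) \<le> c i" for i
        using tangent[OF w[of i]] by (simp add: c_def algebra_simps)
      have large_ge: "1 \<le> c i" if "i \<in> - I" for i
      proof -
        have "0 \<le> (\<rho> * \<bar>x $ i\<bar> - d) * (1 - w $ i)"
          using that w[of i] by (intro mult_nonneg_nonneg) (auto simp: I_def)
        then show ?thesis using large[of i] by simp
      qed
      then have large_sum: "real (card (- I)) \<le> sum c (- I)"
        using sum_bounded_below[of "- I" 1 c] by simp
      have split: "sum c UNIV = sum c I + sum c (- I)"
        by (subst sum.union_disjoint[symmetric]) auto
      have "F y + \<nu> * real (card (- I)) < F x + \<nu> * sum c UNIV"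
      proof (cases "\<delta> = 0")
        case True
        \<comment> \<open>No small entry is nonzero, so a violated complementarity condition
           sits at a large entry, whose cost exceeds 1.\<close>
        obtain i where i: "(1 - w $ i) * \<bar>x $ i\<bar> \<noteq> 0"
          using bad unfolding ones_minus_inner_abs by (meson sum.neutral)
        have "i \<notin> I"
          using True i by (auto simp: \<delta>_def sum_nonneg_eq_0_iff)
        then have "0 < (\<rho> * \<bar>x $ i\<bar> - d) * (1 - w $ i)"
          using i w[of i] by (intro mult_pos_pos) (auto simp: I_def less_le)
        then have "1 < c i" using large[of i] by simp
        then have "(\<Sum>i\<in>- I. 1) < sum c (- I)"
          using \<open>i \<notin> I\<close> large_ge by (intro sum_strict_mono_ex1) auto
        then have "\<nu> * real (card (- I)) < \<nu> * sum c UNIV"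
          using split small True \<open>\<nu> > 0\<close> by simp
        then show ?thesis using change True by simp
      next
        case False
        then have "L * \<gamma> * \<delta> < \<nu> * (\<rho> / d) * \<delta>"
          using rate \<open>\<delta> \<ge> 0\<close> by (intro mult_strict_right_mono) auto
        also have "\<dots> \<le> \<nu> * sum c I"
          using mult_left_mono[OF small, of \<nu>] \<open>\<nu> > 0\<close> by (simp add: mult.assoc)
        finally show ?thesis
          using change mult_left_mono[OF large_sum, of \<nu>] \<open>\<nu> > 0\<close>
          unfolding split distrib_left by linarith
      qed
      then show ?thesis
        using y(1) v compl cost val_y by (intro bexI[of _ y] bexI[of _ v]) (auto simp: P_def)
    qed
  qed
  ultimately show ?thesis by blast
qed

section \<open>Equality of the solution sets\<close>

lemma argmin_set_eq_of_domination:
  assumes sub: "T \<subseteq> S" and eq: "\<And>z. z \<in> T \<Longrightarrow> g z = h z"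
    and dom: "\<And>z. z \<in> S \<Longrightarrow> z \<notin> T \<Longrightarrow> \<exists>z'\<in>T. h z' < g z"
  shows "argmin_set S g = argmin_set T h"
proof (intro equalityI subsetI)
  fix z assume "z \<in> argmin_set S g"
  then have z: "z \<in> S" "\<And>y. y \<in> S \<Longrightarrow> \<not> g y < g z"
    by (auto simp: argmin_set_def is_arg_min_def)
  have "z \<in> T"
    using dom[OF z(1)] z(2) sub eq by (metis subsetD)
  moreover have "\<not> h y < h z" if "y \<in> T" for y
    using z(2)[of y] that sub eq[OF that] eq[OF \<open>z \<in> T\<close>] by auto
  ultimately show "z \<in> argmin_set T h"
    by (auto simp: argmin_set_def is_arg_min_def)
next
  fix z assume "z \<in> argmin_set T h"
  then have z: "z \<in> T" "\<And>y. y \<in> T \<Longrightarrow> \<not> h y < h z"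
    by (auto simp: argmin_set_def is_arg_min_def)
  have "\<not> g y < g z" if "y \<in> S" for y
  proof (cases "y \<in> T")
    case False
    with dom[OF that] obtain z' where "z' \<in> T" "h z' < g y" by blast
    then show ?thesis using z eq by (metis not_less order_trans less_imp_le)
  qed (use z eq in auto)
  then show "z \<in> argmin_set S g"
    using z(1) sub by (auto simp: argmin_set_def is_arg_min_def)
qed

text \<open>
  On \<open>[0, 1]\<close> the function is real-valued, so the two objectives may be compared as real
  numbers. The tangent bound at the minimizer, where the function is 0, forces \<open>d > 0\<close>.
\<close>

lemma family_L_real_representation:
  assumes "\<phi> \<in> family_L" and "finite_left_derivative_at_1 \<phi>"
  obtains \<psi> :: "real \<Rightarrow> real" and d t where
    "\<And>s. 0 \<le> s \<Longrightarrow> s \<le> 1 \<Longrightarrow> \<phi> s = ereal (\<psi> s)"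
    "\<And>s. 0 \<le> s \<Longrightarrow> s \<le> 1 \<Longrightarrow> 0 \<le> \<psi> s"
    "\<And>s. 0 \<le> s \<Longrightarrow> s \<le> 1 \<Longrightarrow> 1 - d * (1 - s) \<le> \<psi> s"
    "\<psi> 1 = 1" "\<psi> t = 0" "0 \<le> t" "t \<le> 1" "d > 0"
proof -
  define \<psi> where "\<psi> s = real_of_ereal (\<phi> s)" for s
  have L: "proper_function \<phi>" "{0..1} \<subseteq> interior (effective_domain \<phi>)"
    "convex_on {0..1} \<psi>" "\<phi> 1 = 1"
    using assms(1) unfolding family_L_def \<psi>_def[abs_def] by auto
  obtain t where t: "argmin_set {0..1} \<phi> = {t}" "t < 1" "\<phi> t = 0"
    using assms(1) by (auto simp: family_L_def)
  then have "t \<in> argmin_set {0..1} \<phi>" by simp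
  then have t_in: "0 \<le> t" "t \<le> 1" and t_min: "\<And>s. 0 \<le> s \<Longrightarrow> s \<le> 1 \<Longrightarrow> 0 \<le> \<phi> s"
    using t(3) by (auto simp: argmin_set_def is_arg_min_def not_less)
  have real: "\<phi> s = ereal (\<psi> s)" if "0 \<le> s" "s \<le> 1" for s
  proof -
    have "s \<in> effective_domain \<phi>" using L(2) that interior_subset by fastforce
    then have "\<bar>\<phi> s\<bar> \<noteq> \<infinity>"
      using L(1) by (auto simp: effective_domain_def proper_function_def)
    then show ?thesis by (simp add: \<psi>_def ereal_real)
  qed
  have one: "\<psi> 1 = 1" and zero: "\<psi> t = 0" using L(4) t(3) by (simp_all add: \<psi>_def)
  obtain d where d: "(\<psi> has_real_derivative d) (at_left 1)"
    using assms(2) unfolding finite_left_derivative_at_1_def \<psi>_def by blast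
  have tan: "1 - d * (1 - s) \<le> \<psi> s" if "0 \<le> s" "s \<le> 1" for s
    using convex_on_Icc_above_left_tangent[OF L(3) d that] one by simp
  have "d * (1 - t) > 0" using tan[OF t_in] zero by simp
  then have "d > 0" using t(2) by (simp add: zero_less_mult_iff)
  then show ?thesis
    using that[of \<psi> d t] real t_min tan one zero t_in by (metis ereal_less_eq(5))
qed

lemma exact_penalty:
  fixes A :: "real ^ 'p ^ 'n" and f :: "real ^ 'n \<Rightarrow> real"
  assumes "polyhedron \<Omega>" and "\<Omega> \<noteq> {}" and "\<mu> > 0" and "\<nu> > 0"
    and "\<phi> \<in> family_L" and "finite_left_derivative_at_1 \<phi>"
    and bdd: "bdd_below (range f)" and lip: "\<And>S. bounded S \<Longrightarrow> \<exists>L. L-lipschitz_on S f"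
  shows "\<exists>\<rho>0 > 0. \<forall>\<rho> \<ge> \<rho>0.
           penalty_solutions \<rho> \<mu> \<nu> \<phi> f A b \<Omega> = constrained_solutions \<mu> \<nu> \<phi> f A b \<Omega>"
proof -
  obtain \<psi> d t where \<psi>: "\<And>s. 0 \<le> s \<Longrightarrow> s \<le> 1 \<Longrightarrow> \<phi> s = ereal (\<psi> s)"
    "\<And>s. 0 \<le> s \<Longrightarrow> s \<le> 1 \<Longrightarrow> 0 \<le> \<psi> s"
    "\<And>s. 0 \<le> s \<Longrightarrow> s \<le> 1 \<Longrightarrow> 1 - d * (1 - s) \<le> \<psi> s"
    "\<psi> 1 = 1" "\<psi> t = 0" "0 \<le> t" "t \<le> 1" "d > 0"
    by (rule family_L_real_representation[OF assms(5,6)]) (rule that)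
  define F where "F = F_mu \<mu> f A b"
  obtain x0 where x0: "x0 \<in> \<Omega>" using assms(2) by blast
  obtain R where R: "\<And>x. norm x > R \<Longrightarrow> F x > F x0 + \<nu> * real CARD('p)"
    using F_mu_coercive[OF bdd \<open>\<mu> > 0\<close>] unfolding F_def by blast
  have F_lip: "\<exists>L. L-lipschitz_on S F" if "bounded S" for S
    unfolding F_def using F_mu_lipschitz_on_bounded[OF lip \<open>\<mu> > 0\<close> that] .
  obtain \<rho>0 where "\<rho>0 > 0" and dom: "\<And>\<rho> x w. \<rho> \<ge> \<rho>0 \<Longrightarrow> x \<in> \<Omega> \<Longrightarrow> w \<in> unit_box \<Longrightarrow>
      (ones - w) \<bullet> abs_vec_entries x \<noteq> 0 \<Longrightarrow>
      \<exists>y\<in>\<Omega>. \<exists>v\<in>unit_box. (ones - v) \<bullet> abs_vec_entries y = 0 \<and>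
        F y + \<nu> * (\<Sum>i\<in>UNIV. \<psi> (v $ i)) <
        F x + \<nu> * ((\<Sum>i\<in>UNIV. \<psi> (w $ i)) + \<rho> * ((ones - w) \<bullet> abs_vec_entries x))"
    using exact_penalty_domination[OF assms(1) x0 \<open>\<nu> > 0\<close> \<psi>(8,2,3,4,5,6,7) F_lip R] by metis
  have sum_real: "(\<Sum>i\<in>UNIV. \<phi> (w $ i)) = ereal (\<Sum>i\<in>UNIV. \<psi> (w $ i))"
    if "w \<in> unit_box" for w :: "real ^ 'p"
    unfolding sum_ereal[symmetric] using that \<psi>(1) by (intro sum.cong) (auto simp: unit_box_def)
  have "penalty_solutions \<rho> \<mu> \<nu> \<phi> f A b \<Omega> = constrained_solutions \<mu> \<nu> \<phi> f A b \<Omega>"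
    if "\<rho> \<ge> \<rho>0" for \<rho>
    unfolding penalty_solutions_def constrained_solutions_def F_def[symmetric]
  proof (rule argmin_set_eq_of_domination, goal_cases)
    case (3 z)
    obtain x w where z: "z = (x, w)" by fastforce
    with 3 have "x \<in> \<Omega>" "w \<in> unit_box" "(ones - w) \<bullet> abs_vec_entries x \<noteq> 0" by auto
    from dom[OF that this] obtain y v where "y \<in> \<Omega>" "v \<in> unit_box"
      "(ones - v) \<bullet> abs_vec_entries y = 0"
      "F y + \<nu> * (\<Sum>i\<in>UNIV. \<psi> (v $ i)) <
        F x + \<nu> * ((\<Sum>i\<in>UNIV. \<psi> (w $ i)) + \<rho> * ((ones - w) \<bullet> abs_vec_entries x))"
      by blast
    then show ?case
      using \<open>w \<in> unit_box\<close> unfolding z by (intro bexI[of _ "(y, v)"]) (auto simp: sum_real)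
  qed auto
  with \<open>\<rho>0 > 0\<close> show ?thesis by blast
qed

theorem theorem3p1:
  fixes A :: "real ^ 'p ^ 'n" and b :: "real ^ 'n" and \<Omega> :: "(real ^ 'p) set"
    and \<mu> \<nu> :: real and \<phi> :: "real \<Rightarrow> ereal"
  assumes "polyhedron \<Omega>" and "\<Omega> \<noteq> {}" and "\<mu> > 0" and "\<nu> > 0"
    and "\<phi> \<in> family_L" and "finite_left_derivative_at_1 \<phi>"
  shows "(\<forall>f :: real ^ 'n \<Rightarrow> real.
            (\<forall>y. f y \<ge> 0) \<and> piecewise_linear_quadratic f \<and> convex_on UNIV f \<longrightarrow>
            (\<exists>\<rho>0 > 0. \<forall>\<rho> \<ge> \<rho>0.
               penalty_solutions \<rho> \<mu> \<nu> \<phi> f A b \<Omega> = constrained_solutions \<mu> \<nu> \<phi> f A b \<Omega>)) \<and>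
         (\<forall>f :: real ^ 'n \<Rightarrow> real.
            bdd_below (range f) \<and> (\<exists>L. L-lipschitz_on UNIV f) \<longrightarrow>
            (\<exists>\<rho>0 > 0. \<forall>\<rho> \<ge> \<rho>0.
               penalty_solutions \<rho> \<mu> \<nu> \<phi> f A b \<Omega> = constrained_solutions \<mu> \<nu> \<phi> f A b \<Omega>))"
proof (intro conjI allI impI)
  fix f :: "real ^ 'n \<Rightarrow> real"
  assume f: "(\<forall>y. f y \<ge> 0) \<and> piecewise_linear_quadratic f \<and> convex_on UNIV f"
  then have "bdd_below (range f)" by (auto intro: bdd_belowI[of _ 0])
  then show "\<exists>\<rho>0 > 0. \<forall>\<rho> \<ge> \<rho>0.
      penalty_solutions \<rho> \<mu> \<nu> \<phi> f A b \<Omega> = constrained_solutions \<mu> \<nu> \<phi> f A b \<Omega>"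
    using f convex_on_UNIV_imp_lipschitz_on_bounded by (intro exact_penalty assms) auto
next
  fix f :: "real ^ 'n \<Rightarrow> real"
  assume f: "bdd_below (range f) \<and> (\<exists>L. L-lipschitz_on UNIV f)"
  then have "\<exists>L. L-lipschitz_on S f" for S
    using lipschitz_on_subset[of _ UNIV f S] by blast
  then show "\<exists>\<rho>0 > 0. \<forall>\<rho> \<ge> \<rho>0.
      penalty_solutions \<rho> \<mu> \<nu> \<phi> f A b \<Omega> = constrained_solutions \<mu> \<nu> \<phi> f A b \<Omega>"
    using f by (intro exact_penalty assms) auto
qed

end
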